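(* Let $\epsilon_0>0$ be sufficiently small that $\ln\ln\frac1\epsilon$ is positive for $0<\epsilon\le\epsilon_0$, and let $$\pi(\epsilon)=\frac{1}{\epsilon\,\ln\frac1\epsilon\,\bigl(\ln\ln\frac1\epsilon\bigr)^2},\qquad \epsilon\in(0,\epsilon_0),$$ with $\pi(\epsilon)=0$ elsewhere on $[0,1]$. In the one-sided unbounded forecasting game, by the Bayesian strategy with prior density $\pi$, Skeptic weakly forces the event $$A_\infty=\infty\ \Longrightarrow\ \limsup_n\frac{S_n}{\sqrt{2A_n^2\ln\ln A_n^2}}\le1 .$$
   Context: One-sided unbounded forecasting game (OUFG). Skeptic starts with an initial capital $\mathcal K_0>0$. On each round $n=1,2,\dots$, Skeptic announces $M_n\in\mathbb R$, then Reality announces $x_n\in[-1,\infty)$, and $\mathcal K_n=\mathcal K_{n-1}+M_nx_n$. Skeptic must keep $\mathcal K_n\ge 0$ for all $n$ whatever Reality does. A path is an infinite sequence $(x_n)_{n\ge1}$ in $[-1,\infty)$; an event is a set of paths. A strategy of Skeptic ($M_n$ as a function of $x_1,\dots,x_{n-1}$, keeping the capital nonnegative on every path) weakly forces an event $E$ if $\limsup_n\mathcal K_n=\infty$ on every path not in $E$. The event "$P\Rightarrow Q$" is the set of paths for which $P$ fails or $Q$ holds. Notation: $S_n=x_1+\dots+x_n$, $A_n^2=x_1^2+\dots+x_n^2$ with $A_n\ge0$, $A_\infty=\lim_nA_n$. The Bayesian strategy with prior density $\pi$ (a nonnegative integrable function on $[0,1]$ with positive integral, not necessarily $1$) bets $M_n=\epsilon_n\mathcal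 K_{n-1}$ where $$\epsilon_n=\frac{\int_0^1\epsilon\prod_{i=1}^{n-1}(1+\epsilon x_i)\pi(\epsilon)\,d\epsilon}{\int_0^1\prod_{i=1}^{n-1}(1+\epsilon x_i)\pi(\epsilon)\,d\epsilon},$$ with initial capital $\int_0^1\pi(\epsilon)d\epsilon$; its capital process is $\mathcal K_n^\pi=\int_0^1\prod_{i=1}^n(1+\epsilon x_i)\pi(\epsilon)\,d\epsilon$. *)

theory Defs
  imports "HOL-Analysis.Analysis"
begin

section \<open>The one-sided unbounded forecasting game\<close>

text \<open>
  A path is a sequence with \<open>x i\<close> standing for Reality's move \<open>x\<^sub>i\<^sub>+\<^sub>1\<close>; thus the moves of the
  first \<open>n\<close> rounds are \<open>x 0, \<dots>, x (n - 1)\<close>. A strategy maps the list of Reality's previous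
  moves, in chronological order, to Skeptic's next move \<open>M\<close>.
\<close>

type_synonym strategy = "real list \<Rightarrow> real"

definition paths :: "(nat \<Rightarrow> real) set" where
  "paths = {x. \<forall>i. -1 \<le> x i}"

definition history :: "(nat \<Rightarrow> real) \<Rightarrow> nat \<Rightarrow> real list" where
  "history x n = map x [0..<n]"

definition capital :: "real \<Rightarrow> strategy \<Rightarrow> real list \<Rightarrow> real" where
  "capital K0 M xs = K0 + (\<Sum>i<length xs. M (take i xs) * xs ! i)"

definition weakly_forces :: "real \<Rightarrow> strategy \<Rightarrow> (nat \<Rightarrow> real) set \<Rightarrow> bool" where
  "weakly_forces K0 M E \<longleftrightarrow>
     0 < K0 \<and>
     (\<forall>x\<in>paths. \<forall>n. 0 \<le> capital K0 M (history x n)) \<and>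
     (\<forall>x\<in>paths. x \<notin> E \<longrightarrow> limsup (\<lambda>n. ereal (capital K0 M (history x n))) = \<infinity>)"


section \<open>Bayesian strategies\<close>

lemma capital_cong [fundef_cong]:
  assumes "K0 = K0'" "xs = xs'" "\<And>i. i < length xs' \<Longrightarrow> M (take i xs') = M' (take i xs')"
  shows "capital K0 M xs = capital K0' M' xs'"
  using assms by (simp add: capital_def)

text \<open>
  The strategy that bets the fraction \<open>e xs\<close> of the current capital after history \<open>xs\<close>, i.e.
  \<open>M\<^sub>n = \<epsilon>\<^sub>n K\<^sub>n\<^sub>-\<^sub>1\<close>. The recursion is well-founded since the capital after \<open>xs\<close> depends only on
  the bets made after proper prefixes of \<open>xs\<close>.
\<close>

function fractional_strategy :: "real \<Rightarrow> (real list \<Rightarrow> real) \<Rightarrow> strategy" where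
  "fractional_strategy K0 e xs = e xs * capital K0 (fractional_strategy K0 e) xs"
  by auto
termination
  by (relation "Wellfounded.measure (\<lambda>(K0, e, xs). length xs)") auto

declare fractional_strategy.simps [simp del]

definition bayes_initial :: "(real \<Rightarrow> real) \<Rightarrow> real" where
  "bayes_initial p = (LBINT e:{0..1}. p e)"

definition bayes_fraction :: "(real \<Rightarrow> real) \<Rightarrow> real list \<Rightarrow> real" where
  "bayes_fraction p xs =
     (LBINT e:{0..1}. e * (\<Prod>x\<leftarrow>xs. 1 + e * x) * p e) /
     (LBINT e:{0..1}. (\<Prod>x\<leftarrow>xs. 1 + e * x) * p e)"

definition bayes_strategy :: "(real \<Rightarrow> real) \<Rightarrow> strategy" where
  "bayes_strategy p = fractional_strategy (bayes_initial p) (bayes_fraction p)"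

definition lil_prior :: "real \<Rightarrow> real \<Rightarrow> real" where
  "lil_prior \<epsilon>0 \<epsilon> =
     (if 0 < \<epsilon> \<and> \<epsilon> < \<epsilon>0 then 1 / (\<epsilon> * ln (1 / \<epsilon>) * (ln (ln (1 / \<epsilon>)))\<^sup>2) else 0)"


section \<open>Path functionals\<close>

definition path_sum :: "(nat \<Rightarrow> real) \<Rightarrow> nat \<Rightarrow> real" where
  "path_sum x n = (\<Sum>i<n. x i)"

definition path_A :: "(nat \<Rightarrow> real) \<Rightarrow> nat \<Rightarrow> real" where
  "path_A x n = sqrt (\<Sum>i<n. (x i)\<^sup>2)"

definition path_A_inf :: "(nat \<Rightarrow> real) \<Rightarrow> ereal" where
  "path_A_inf x = lim (\<lambda>n. ereal (path_A x n))"

end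

theory Submission
  imports Defs "HOL-Real_Asymp.Real_Asymp"
begin

text \<open>
  The capital of the Bayesian strategy is the mixture of the wealth processes
  \<open>\<Prod>(1 + \<epsilon> x\<^sub>i)\<close>. For \<open>x \<ge> -1\<close> one has \<open>1 + \<epsilon> x \<ge> exp (\<epsilon> x - \<epsilon>\<^sup>2 x\<^sup>2 / (2 (1 - \<epsilon>)))\<close> without
  any upper bound on \<open>x\<close>, so the integrand is at least \<open>exp (\<epsilon> S - \<epsilon>\<^sup>2 A\<^sup>2 / (2 (1 - \<epsilon>)))\<close>. If
  \<open>S \<ge> a A\<close> with \<open>a = r \<surd>(2 ln ln A\<^sup>2)\<close> and \<open>r > 1\<close>, then for large \<open>A\<close> on \<open>(a - 1) / A \<le> \<epsilon> \<le> a / A\<close> this is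
  at least \<open>exp (a\<^sup>2 / 2 - 1) = (2 ln A) powr r\<^sup>2 / exp 1\<close>, while this interval has prior mass at
  least \<open>1 / (a ln A (ln ln A)\<^sup>2)\<close>. The product tends to infinity with \<open>A\<close>.
\<close>

section \<open>Capital of Bayesian strategies\<close>

text \<open>The candidate closed form of the recursively defined capital. It is also the denominator
  of \<open>bayes_fraction\<close> and so cancels in the bet.\<close>

definition bayes_capital :: "(real \<Rightarrow> real) \<Rightarrow> real list \<Rightarrow> real" where
  "bayes_capital p xs = (LBINT e:{0..1}. (\<Prod>x\<leftarrow>xs. 1 + e * x) * p e)"

lemma set_integrable_mult_ident:
  fixes f :: "real \<Rightarrow> real"
  assumes "set_integrable lborel {0..1} f"
  shows "set_integrable lborel {0..1} (\<lambda>e. e * f e)"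
proof -
  have int: "integrable lborel (\<lambda>e. indicator {0..1} e * f e)"
    using assms by (simp add: set_integrable_def)
  have "integrable lborel (\<lambda>e. e * (indicator {0..1} e * f e))"
  proof (rule Bochner_Integration.integrable_bound[OF int])
    have [measurable]: "(\<lambda>e. indicator {0..1} e * f e) \<in> borel_measurable lborel"
      using int by simp
    show "(\<lambda>e. e * (indicator {0..1} e * f e)) \<in> borel_measurable lborel"
      by measurable
    show "AE e in lborel. norm (e * (indicator {0..1} e * f e)) \<le> norm (indicator {0..1} e * f e)"
      by (intro AE_I2) (auto simp: indicator_def abs_mult mult_left_le_one_le)
  qed
  then show ?thesis
    by (simp add: set_integrable_def mult_ac)
qed

text \<open>A new move \<open>x\<close> turns the integrand \<open>g\<close> into
  \<open>g + x * (e * g)\<close>, and multiplication by \<open>e\<close> keeps integrability because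
  \<open>e\<close> is bounded on the unit interval.\<close>

lemma set_integrable_bayes:
  fixes p :: "real \<Rightarrow> real"
  assumes "set_integrable lborel {0..1} p"
  shows "set_integrable lborel {0..1} (\<lambda>e. (\<Prod>x\<leftarrow>xs. 1 + e * x) * p e)"
proof (induction xs)
  case Nil
  then show ?case using assms by simp
next
  case (Cons x xs)
  let ?g = "\<lambda>e. (\<Prod>x\<leftarrow>xs. 1 + e * x) * p e"
  have "set_integrable lborel {0..1} (\<lambda>e. ?g e + x * (e * ?g e))"
    using Cons by (intro set_integral_add set_integrable_mult_right set_integrable_mult_ident)
  then show ?case
    by (simp add: algebra_simps)
qed

lemma prod_list_bet_nonneg:
  fixes e :: real
  assumes "\<forall>x\<in>set xs. -1 \<le> x" "0 \<le> e" "e \<le> 1"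
  shows "0 \<le> (\<Prod>x\<leftarrow>xs. 1 + e * x)"
  using assms(1)
proof (induction xs)
  case (Cons x xs)
  have "e * (-1) \<le> e * x"
    using Cons.prems assms(2) by (intro mult_left_mono) auto
  then show ?case
    using Cons assms(3) by simp
qed simp

lemma bayes_capital_nonneg:
  assumes "\<forall>e\<in>{0..1}. 0 \<le> p e" "\<forall>x\<in>set xs. -1 \<le> x"
  shows "0 \<le> bayes_capital p xs"
  unfolding bayes_capital_def set_lebesgue_integral_def
  using assms by (intro integral_nonneg_AE AE_I2) (auto simp: indicator_def prod_list_bet_nonneg)

text \<open>A vanishing capital, where the fraction is the junk value \<open>x / 0\<close>, is covered as well: then
  the integrand vanishes almost everywhere, and so does the numerator.\<close>

lemma bayes_fraction_mult_capital:
  assumes int: "set_integrable lborel {0..1} p" and nn: "\<forall>e\<in>{0..1}. 0 \<le> p e"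
    and xs: "\<forall>x\<in>set xs. -1 \<le> x"
  shows "bayes_fraction p xs * bayes_capital p xs =
    (LBINT e:{0..1}. e * (\<Prod>x\<leftarrow>xs. 1 + e * x) * p e)"
proof (cases "bayes_capital p xs = 0")
  case True
  let ?g = "\<lambda>e. indicator {0..1} e *\<^sub>R ((\<Prod>x\<leftarrow>xs. 1 + e * x) * p e)"
  have "AE e in lborel. ?g e = 0"
  proof (subst integral_nonneg_eq_0_iff_AE[symmetric])
    show "integrable lborel ?g"
      using set_integrable_bayes[OF int] by (simp add: set_integrable_def)
    show "AE e in lborel. 0 \<le> ?g e"
      using nn xs by (intro AE_I2) (auto simp: indicator_def prod_list_bet_nonneg)
    show "integral\<^sup>L lborel ?g = 0"
      using True by (simp add: bayes_capital_def set_lebesgue_integral_def)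
  qed
  then have "(LBINT e:{0..1}. e * (\<Prod>x\<leftarrow>xs. 1 + e * x) * p e) = 0"
    unfolding set_lebesgue_integral_def
    by (intro integral_eq_zero_AE) (auto elim!: eventually_mono)
  then show ?thesis using True by simp
next
  case False
  then show ?thesis by (simp add: bayes_fraction_def bayes_capital_def)
qed

lemma capital_snoc: "capital K0 M (xs @ [x]) = capital K0 M xs + M xs * x"
  by (simp add: capital_def nth_append)

text \<open>With \<open>g\<close> the current integrand, the bet is the integral of
  \<open>e * g\<close>, so a move \<open>x\<close> changes the capital from the integral of
  \<open>g\<close> to that of \<open>(1 + e * x) * g\<close>.\<close>

lemma capital_bayes_strategy:
  assumes int: "set_integrable lborel {0..1} p" and nn: "\<forall>e\<in>{0..1}. 0 \<le> p e"
    and "\<forall>x\<in>set xs. -1 \<le> x"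
  shows "capital (bayes_initial p) (bayes_strategy p) xs = bayes_capital p xs"
  using assms(3)
proof (induction xs rule: rev_induct)
  case Nil
  then show ?case by (simp add: capital_def bayes_initial_def bayes_capital_def)
next
  case (snoc x xs)
  let ?g = "\<lambda>e. (\<Prod>x\<leftarrow>xs. 1 + e * x) * p e"
  have ints: "set_integrable lborel {0..1} ?g" "set_integrable lborel {0..1} (\<lambda>e. e * ?g e)"
    using set_integrable_bayes[OF int] set_integrable_mult_ident by blast+
  have IH: "capital (bayes_initial p) (bayes_strategy p) xs = bayes_capital p xs"
    using snoc by simp
  have "bayes_strategy p xs = bayes_fraction p xs * bayes_capital p xs"
    using IH unfolding bayes_strategy_def by (subst fractional_strategy.simps) simp
  also have "\<dots> = (LBINT e:{0..1}. e * ?g e)"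
    using bayes_fraction_mult_capital[OF int nn, of xs] snoc.prems by (simp add: mult.assoc)
  finally have "capital (bayes_initial p) (bayes_strategy p) (xs @ [x])
      = (LBINT e:{0..1}. ?g e) + (LBINT e:{0..1}. x * (e * ?g e))"
    by (simp add: capital_snoc IH bayes_capital_def mult.commute)
  also have "\<dots> = (LBINT e:{0..1}. ?g e + x * (e * ?g e))"
    using ints by (intro set_integral_add(2)[symmetric] set_integrable_mult_right)
  also have "\<dots> = bayes_capital p (xs @ [x])"
    by (simp add: bayes_capital_def algebra_simps)
  finally show ?case .
qed


section \<open>An exponential lower bound for the wealth products\<close>

text \<open>The difference of the two sides vanishes at 0. Its derivative
  \<open>s * (1 / (1 - e) - 1 / (1 + s))\<close> changes sign only there, because
  \<open>1 + s\<close> is at least \<open>1 - e\<close>; hence 0 is a minimum.\<close>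

lemma ln_one_plus_ge_quadratic:
  fixes t e :: real
  assumes "0 \<le> e" "e < 1" "-e \<le> t"
  shows "t - t\<^sup>2 / (2 * (1 - e)) \<le> ln (1 + t)"
proof -
  define f where "f = (\<lambda>s. ln (1 + s) - (s - s\<^sup>2 / (2 * (1 - e))))"
  have der: "DERIV f s :> s * (1 / (1 - e) - 1 / (1 + s))" if "-e \<le> s" for s
  proof -
    have "1 + s > 0" "1 - e > 0" using that assms by auto
    then show ?thesis
      unfolding f_def
      by (auto intro!: derivative_eq_intros simp: divide_simps) (simp add: algebra_simps)
  qed
  have le: "1 / (1 + s) \<le> 1 / (1 - e)" if "-e \<le> s" for s
    using that assms by (intro divide_left_mono mult_pos_pos) auto
  have "f 0 \<le> f t"
  proof (cases "0 \<le> t")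
    case True
    show ?thesis
    proof (rule DERIV_nonneg_imp_nondecreasing[OF True])
      fix s assume "0 \<le> s" "s \<le> t"
      then have "-e \<le> s" using assms by simp
      from der[OF this] le[OF this] \<open>0 \<le> s\<close>
      show "\<exists>y. DERIV f s :> y \<and> 0 \<le> y"
        by (intro exI conjI) (assumption, auto intro!: mult_nonneg_nonneg)
    qed
  next
    case False
    show ?thesis
    proof (rule DERIV_nonpos_imp_nonincreasing[of t 0])
      fix s assume "t \<le> s" "s \<le> 0"
      then have "-e \<le> s" using assms by simp
      from der[OF this] le[OF this] \<open>s \<le> 0\<close>
      show "\<exists>y. DERIV f s :> y \<and> y \<le> 0"
        by (intro exI conjI) (assumption, auto intro!: mult_nonpos_nonneg)
    qed (use False in simp)
  qed
  then show ?thesis by (simp add: f_def)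
qed

text \<open>A move \<open>x \<ge> -1\<close> gives \<open>e * x \<ge> -e\<close>, so the logarithmic
  bound holds for every factor with the same denominator, and the exponents add up.\<close>

lemma exp_le_prod_list_bet:
  fixes e :: real
  assumes "\<forall>x\<in>set xs. -1 \<le> x" "0 \<le> e" "e < 1"
  shows "exp (e * sum_list xs - e\<^sup>2 * (\<Sum>x\<leftarrow>xs. x\<^sup>2) / (2 * (1 - e))) \<le> (\<Prod>x\<leftarrow>xs. 1 + e * x)"
  using assms(1)
proof (induction xs)
  case (Cons x xs)
  have "e * (-1) \<le> e * x"
    using Cons.prems assms(2) by (intro mult_left_mono) auto
  then have ge: "-e \<le> e * x" and pos: "0 < 1 + e * x"
    using assms by auto
  have "exp (e * x - (e * x)\<^sup>2 / (2 * (1 - e))) \<le> exp (ln (1 + e * x))"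
    using ln_one_plus_ge_quadratic[OF assms(2,3) ge] by simp
  also have "\<dots> = 1 + e * x" using pos by simp
  finally have "exp (e * x - (e * x)\<^sup>2 / (2 * (1 - e))) *
      exp (e * sum_list xs - e\<^sup>2 * (\<Sum>x\<leftarrow>xs. x\<^sup>2) / (2 * (1 - e)))
      \<le> (1 + e * x) * (\<Prod>x\<leftarrow>xs. 1 + e * x)"
    using Cons pos by (intro mult_mono) auto
  also have "exp (e * x - (e * x)\<^sup>2 / (2 * (1 - e))) *
      exp (e * sum_list xs - e\<^sup>2 * (\<Sum>x\<leftarrow>xs. x\<^sup>2) / (2 * (1 - e)))
      = exp (e * sum_list (x # xs) - e\<^sup>2 * (\<Sum>x\<leftarrow>x # xs. x\<^sup>2) / (2 * (1 - e)))"
    by (simp add: exp_add[symmetric] power_mult_distrib algebra_simps add_divide_distrib)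
  finally show ?case by simp
qed simp


section \<open>The prior\<close>

locale lil_threshold =
  fixes \<epsilon>0 :: real
  assumes pos: "0 < \<epsilon>0"
    and ln_ln_pos: "\<And>\<epsilon>. 0 < \<epsilon> \<Longrightarrow> \<epsilon> \<le> \<epsilon>0 \<Longrightarrow> 0 < ln (ln (1 / \<epsilon>))"
begin

text \<open>At \<open>exp (-1)\<close> the iterated logarithm is 0, so this point cannot lie at or
  below \<open>\<epsilon>0\<close>.\<close>

lemma less_one: "\<epsilon>0 < 1"
proof (rule ccontr)
  assume "\<not> \<epsilon>0 < 1"
  moreover have "exp (-1) \<le> (1::real)" by simp
  ultimately have "exp (-1) \<le> \<epsilon>0" by linarith
  from ln_ln_pos[OF _ this] show False by (simp add: exp_minus inverse_eq_divide)
qed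

lemma ln_pos: "0 < \<epsilon> \<Longrightarrow> \<epsilon> \<le> \<epsilon>0 \<Longrightarrow> 0 < ln (1 / \<epsilon>)"
  using less_one by simp

lemma prior_nonneg: "0 \<le> lil_prior \<epsilon>0 \<epsilon>"
  using ln_pos[of \<epsilon>] by (auto simp: lil_prior_def simp del: ln_div intro!: divide_nonneg_nonneg mult_nonneg_nonneg)

text \<open>The prior has the explicit antiderivative \<open>1 / ln (ln (1 / \<epsilon>))\<close>.\<close>

lemma prior_integral:
  shows "set_integrable lborel {0..1} (lil_prior \<epsilon>0)"
    and "(LBINT e:{0..1}. lil_prior \<epsilon>0 e) = 1 / ln (ln (1 / \<epsilon>0))"
proof -
  let ?F = "\<lambda>e::real. 1 / ln (ln (1 / e))"
  let ?f = "\<lambda>e::real. 1 / (e * ln (1 / e) * (ln (ln (1 / e)))\<^sup>2)"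
  have der: "DERIV ?F e :> ?f e" if "0 < e" "e \<le> \<epsilon>0" for e
    using that ln_pos[OF that] ln_ln_pos[OF that]
    by (auto intro!: derivative_eq_intros simp: power2_eq_square field_simps simp del: ln_div)
  have cont: "isCont ?f e" if "0 < e" "e < \<epsilon>0" for e
    using that ln_pos[of e] ln_ln_pos[of e]
    by (intro continuous_intros) (auto simp del: ln_div)
  \<comment> \<open>The prior is singular at 0; its integrability comes from the finite limit of the
    antiderivative there.\<close>
  have A: "((?F \<circ> real_of_ereal) \<longlongrightarrow> 0) (at_right (ereal 0))"
    unfolding ereal_tendsto_simps by real_asymp
  have B: "((?F \<circ> real_of_ereal) \<longlongrightarrow> ?F \<epsilon>0) (at_left (ereal \<epsilon>0))"
    unfolding ereal_tendsto_simps
    using der[OF pos order.refl, THEN DERIV_isCont, THEN isContD]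
    by (rule tendsto_within_subset) simp
  have nonneg: "AE e in lborel. ereal 0 < ereal e \<longrightarrow> ereal e < ereal \<epsilon>0 \<longrightarrow> 0 \<le> ?f e"
    using ln_pos by (intro AE_I2) (auto simp: less_imp_le simp del: ln_div ln_ge_zero_iff)
  have ftc: "set_integrable lborel (einterval (ereal 0) (ereal \<epsilon>0)) ?f"
      "(LBINT e=ereal 0..ereal \<epsilon>0. ?f e) = ?F \<epsilon>0 - 0"
    using pos der cont
    by (intro interval_integral_FTC_nonneg[OF _ _ _ nonneg A B]; simp)+
  have eq: "indicator {0..1} e *\<^sub>R lil_prior \<epsilon>0 e = indicator {0<..<\<epsilon>0} e *\<^sub>R ?f e" for e
    using less_one by (auto simp: lil_prior_def indicator_def)
  show "set_integrable lborel {0..1} (lil_prior \<epsilon>0)"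
    using ftc(1) unfolding set_integrable_def eq by simp
  show "(LBINT e:{0..1}. lil_prior \<epsilon>0 e) = 1 / ln (ln (1 / \<epsilon>0))"
    using ftc(2) pos unfolding set_lebesgue_integral_def eq
    by (simp add: interval_lebesgue_integral_def set_lebesgue_integral_def)
qed

lemma bayes_initial_pos: "0 < bayes_initial (lil_prior \<epsilon>0)"
  using prior_integral(2) ln_ln_pos[OF pos order.refl] by (simp add: bayes_initial_def del: ln_div)

text \<open>The three factors of the denominator of the prior are bounded separately:
  \<open>e\<close> by \<open>u / A\<close>, and both logarithms through
  \<open>1 / e \<le> A\<close>.\<close>

lemma prior_ge:
  assumes "0 < e" "e < \<epsilon>0" "e \<le> u / A" "1 / e \<le> A" "0 < A"
  shows "A / (u * ln A * (ln (ln A))\<^sup>2) \<le> lil_prior \<epsilon>0 e"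
proof -
  have l: "0 < ln (1 / e)" "0 < ln (ln (1 / e))"
    using ln_pos[of e] ln_ln_pos[of e] assms by auto
  have lA: "ln (1 / e) \<le> ln A"
    using assms by (subst ln_le_cancel_iff) auto
  have llA: "ln (ln (1 / e)) \<le> ln (ln A)"
    using lA l by (subst ln_le_cancel_iff) auto
  have "0 < ln A" using l lA by linarith
  then have "e * ln (1 / e) * (ln (ln (1 / e)))\<^sup>2 \<le> (u / A) * ln A * (ln (ln A))\<^sup>2"
    using assms l lA llA by (intro mult_mono power_mono mult_nonneg_nonneg)
      (auto simp: less_imp_le simp del: ln_div ln_ge_zero_iff)
  moreover have "0 < e * ln (1 / e) * (ln (ln (1 / e)))\<^sup>2"
    using assms(1) l by (intro mult_pos_pos zero_less_power)
  ultimately have "1 / ((u / A) * ln A * (ln (ln A))\<^sup>2) \<le> lil_prior \<epsilon>0 e"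
    unfolding lil_prior_def using assms by (simp only: simp_thms if_True) (rule frac_le; simp)
  then show ?thesis by simp
qed

text \<open>The point \<open>a / A\<close> maximizes
  \<open>e * a * A - e\<^sup>2 * A\<^sup>2 / 2\<close>, with value \<open>a\<^sup>2 / 2\<close>. On
  the window of length \<open>1 / A\<close> below it, the distance from the maximizer and the factor
  \<open>1 / (1 - e)\<close> each cost at most \<open>1 / 2\<close> in the exponent, which explains
  the \<open>- 1\<close>.\<close>

lemma bayes_capital_ge:
  assumes xs: "\<forall>x\<in>set xs. -1 \<le> x"
    and A: "0 < A" "(\<Sum>x\<leftarrow>xs. x\<^sup>2) = A\<^sup>2"
    and S: "a * A \<le> sum_list xs"
    and a: "2 \<le> a" "a / A < \<epsilon>0" "a / A \<le> 1 / 2" "2 * a ^ 3 / A \<le> 1"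
  shows "exp (a\<^sup>2 / 2 - 1) / (a * ln A * (ln (ln A))\<^sup>2) \<le> bayes_capital (lil_prior \<epsilon>0) xs"
proof -
  define c where "c = exp (a\<^sup>2 / 2 - 1) * (A / (a * ln A * (ln (ln A))\<^sup>2))"
  let ?I = "{(a - 1) / A..a / A}"
  let ?g = "\<lambda>e. (\<Prod>x\<leftarrow>xs. 1 + e * x) * lil_prior \<epsilon>0 e"
  have sub: "?I \<subseteq> {0..1}" using A a by auto
  have "2 / A \<le> a / A" using a A by (intro divide_right_mono) auto
  with a have "2 / A \<le> 1 / 2" by linarith
  \<comment> \<open>This makes \<open>ln A\<close> positive, so the lower bound for the prior is
    nonnegative and may be multiplied with the bound for the product.\<close>
  then have "4 \<le> A" using A by (simp add: field_simps)
  have ge: "c \<le> ?g e" if e: "e \<in> ?I" for e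
  proof -
    define u where "u = e * A"
    have u: "a - 1 \<le> u" "u \<le> a" using e A by (auto simp: u_def field_simps)
    have eu: "e = u / A" using A by (simp add: u_def)
    have e_pos: "0 < e" using u a A by (simp add: eu)
    have e_le: "e \<le> a / A" using e by simp
    with a have e_less: "e < \<epsilon>0" and e_half: "e \<le> 1 / 2" by linarith+
    have "1 / e \<le> A" using u a A by (simp add: eu field_simps)
    then have prior: "A / (a * ln A * (ln (ln A))\<^sup>2) \<le> lil_prior \<epsilon>0 e"
      using prior_ge e_pos e_le e_less A by blast
    text \<open>Since \<open>1 / (1 - e) \<le> 1 + 2 e\<close>, the distortion costs at most \<open>e u\<^sup>2 \<le> a\<^sup>3 / A\<close>.\<close>
    have "1 / (1 - e) \<le> 1 + 2 * e"
    proof -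
      have "0 \<le> e * (1 - 2 * e)" using e_pos e_half by simp
      then show ?thesis using e_half by (simp add: field_simps)
    qed
    then have "u\<^sup>2 / 2 * (1 / (1 - e)) \<le> u\<^sup>2 / 2 * (1 + 2 * e)"
      by (intro mult_left_mono) auto
    also have "\<dots> = u\<^sup>2 / 2 + u\<^sup>2 * e"
      by (simp add: algebra_simps)
    finally have "u\<^sup>2 / 2 * (1 / (1 - e)) \<le> u\<^sup>2 / 2 + u\<^sup>2 * e" .
    moreover have "u\<^sup>2 * e \<le> a\<^sup>2 * (a / A)"
      using u a e_le e_pos by (intro mult_mono power_mono) auto
    moreover have "a\<^sup>2 * (a / A) \<le> 1 / 2"
      using a(4) by (simp add: power2_eq_square power3_eq_cube mult_ac)
    moreover have "a\<^sup>2 + u\<^sup>2 - 2 * (u * a) \<le> 1"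
      using power_le_one[of "a - u" 2] u by (simp add: power2_diff mult_ac)
    ultimately have "a\<^sup>2 / 2 - 1 \<le> u * a - u\<^sup>2 / 2 * (1 / (1 - e))"
      by linarith
    also have "u * a \<le> e * sum_list xs"
      using mult_left_mono[OF S, of e] e_pos by (simp add: u_def mult_ac)
    finally have "a\<^sup>2 / 2 - 1 \<le> e * sum_list xs - e\<^sup>2 * (\<Sum>x\<leftarrow>xs. x\<^sup>2) / (2 * (1 - e))"
      by (simp add: u_def A power_mult_distrib)
    then have "exp (a\<^sup>2 / 2 - 1) \<le> exp (e * sum_list xs - e\<^sup>2 * (\<Sum>x\<leftarrow>xs. x\<^sup>2) / (2 * (1 - e)))"
      by simp
    also have "\<dots> \<le> (\<Prod>x\<leftarrow>xs. 1 + e * x)"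
      using xs e_pos e_half by (intro exp_le_prod_list_bet) auto
    finally show ?thesis
      unfolding c_def using prior \<open>4 \<le> A\<close> a e_pos e_half
      by (intro mult_mono prod_list_bet_nonneg[OF xs]) (auto simp: less_imp_le)
  qed
  \<comment> \<open>The window length \<open>1 / A\<close> cancels the factor \<open>A\<close> in
    \<open>c\<close>; outside the window the integrand is dropped as nonnegative.\<close>
  have "c / A = (LBINT e:?I. c)"
    using A unfolding set_lebesgue_integral_def
    by (simp add: divide_right_mono diff_divide_distrib)
  also have "\<dots> \<le> bayes_capital (lil_prior \<epsilon>0) xs"
    unfolding bayes_capital_def set_lebesgue_integral_def
  proof (rule integral_mono)
    show "integrable lborel (\<lambda>e. indicat_real ?I e *\<^sub>R c)"
      by (intro integrable_scaleR_left integrable_real_indicator)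
        (auto simp: emeasure_lborel_Icc_eq)
    show "integrable lborel (\<lambda>e. indicat_real {0..1} e *\<^sub>R ?g e)"
      using set_integrable_bayes[OF prior_integral(1)] by (simp add: set_integrable_def)
    show "indicat_real ?I e *\<^sub>R c \<le> indicat_real {0..1} e *\<^sub>R ?g e" for e
    proof (cases "e \<in> ?I")
      case True
      then show ?thesis using ge sub by (auto simp: indicator_def)
    next
      case False
      then show ?thesis
        using xs prior_nonneg by (auto simp: indicator_def prod_list_bet_nonneg)
    qed
  qed
  finally show ?thesis using A by (simp add: c_def)
qed

text \<open>The exponential grows like \<open>(ln A) powr r\<^sup>2\<close>, the denominator like
  \<open>ln A\<close> times powers of \<open>ln (ln A)\<close>, and \<open>r\<^sup>2 > 1\<close>.
  The threshold depends on \<open>A\<close> alone and serves all histories at once.\<close>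

lemma eventually_bayes_capital_ge:
  fixes r :: real
  assumes "1 < r"
  shows "eventually (\<lambda>A. \<forall>xs. (\<forall>x\<in>set xs. -1 \<le> x) \<longrightarrow> (\<Sum>x\<leftarrow>xs. x\<^sup>2) = A\<^sup>2 \<longrightarrow>
    r * sqrt (2 * A\<^sup>2 * ln (ln (A\<^sup>2))) \<le> sum_list xs \<longrightarrow> C \<le> bayes_capital (lil_prior \<epsilon>0) xs) at_top"
proof -
  define a where "a = (\<lambda>A. r * sqrt (2 * ln (ln (A\<^sup>2))))"
  have r: "0 < r" "1 < r\<^sup>2" using assms by auto
  have "filterlim (\<lambda>A. exp (r\<^sup>2 * ln (ln (A\<^sup>2)) - 1) / (a A * ln A * (ln (ln A))\<^sup>2)) at_top at_top"
    unfolding a_def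
  proof -
    \<comment> \<open>As an atomic parameter, the exponent can be compared with 1 by the asymptotic
      procedure.\<close>
    define d where "d = r\<^sup>2"
    have "1 < d" using r by (simp add: d_def)
    then show "filterlim (\<lambda>A. exp (r\<^sup>2 * ln (ln (A\<^sup>2)) - 1) /
        (r * sqrt (2 * ln (ln (A\<^sup>2))) * ln A * (ln (ln A))\<^sup>2)) at_top at_top"
      unfolding d_def[symmetric] using r(1) by real_asymp
  qed
  then have "eventually (\<lambda>A. C \<le> exp (r\<^sup>2 * ln (ln (A\<^sup>2)) - 1) / (a A * ln A * (ln (ln A))\<^sup>2)) at_top"
    by (simp add: filterlim_at_top)
  moreover have "eventually (\<lambda>A::real. 0 < A) at_top"
    by (rule eventually_gt_at_top)
  moreover have "eventually (\<lambda>A::real. 0 < ln (ln (A\<^sup>2))) at_top"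
    by real_asymp
  moreover have "eventually (\<lambda>A. 2 \<le> a A) at_top" "eventually (\<lambda>A. a A / A < \<epsilon>0) at_top"
    "eventually (\<lambda>A. a A / A \<le> 1 / 2) at_top" "eventually (\<lambda>A. 2 * a A ^ 3 / A \<le> 1) at_top"
    unfolding a_def using r(1) pos by real_asymp+
  ultimately show ?thesis
  proof eventually_elim
    case (elim A)
    have "(a A)\<^sup>2 / 2 = r\<^sup>2 * ln (ln (A\<^sup>2))"
      using elim by (simp add: a_def power_mult_distrib)
    moreover have "a A * A = r * sqrt (2 * A\<^sup>2 * ln (ln (A\<^sup>2)))"
      using elim by (simp add: a_def real_sqrt_mult)
    ultimately show ?case
      using bayes_capital_ge[of _ A "a A"] elim by fastforce
  qed
qed

end


section \<open>Weak forcing\<close>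

text \<open>Density provides a fixed margin \<open>r\<close> strictly above \<open>c\<close>; for
  \<open>c = 1\<close> it yields the exponent \<open>r\<^sup>2 > 1\<close>.\<close>

lemma limsup_gt_imp_frequently_gt:
  fixes f :: "nat \<Rightarrow> real"
  assumes "ereal c < limsup (\<lambda>n. ereal (f n))"
  obtains r where "c < r" "frequently (\<lambda>n. r < f n) sequentially"
proof -
  obtain r where r: "ereal c < ereal r" "ereal r < limsup (\<lambda>n. ereal (f n))"
    using assms ereal_dense2 by blast
  have "frequently (\<lambda>n. r < f n) sequentially"
  proof (rule ccontr)
    assume "\<not> ?thesis"
    then have "eventually (\<lambda>n. ereal (f n) \<le> ereal r) sequentially"
      by (simp add: not_frequently not_less)
    then have "limsup (\<lambda>n. ereal (f n)) \<le> ereal r"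
      by (rule Limsup_bounded)
    with r show False by simp
  qed
  with r that show ?thesis by simp
qed

lemma limsup_eq_infinityI:
  fixes f :: "nat \<Rightarrow> real"
  assumes "\<And>C. frequently (\<lambda>n. C \<le> f n) sequentially"
  shows "limsup (\<lambda>n. ereal (f n)) = \<infinity>"
proof (rule ccontr)
  assume "\<not> ?thesis"
  then obtain C where "limsup (\<lambda>n. ereal (f n)) < ereal C"
    using less_PInf_Ex_of_nat[of "limsup (\<lambda>n. ereal (f n))"] by auto
  then have "eventually (\<lambda>n. ereal (f n) < ereal C) sequentially"
    by (rule Limsup_lessD)
  then have "\<not> frequently (\<lambda>n. C \<le> f n) sequentially"
    by (simp add: frequently_def not_le)
  with assms show False by blast
qed

text \<open>Monotonicity ensures that the \<open>lim\<close> in \<open>path_A_inf\<close> is a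
  genuine limit in the extended reals.\<close>

lemma path_A_tendsto_at_top:
  assumes "path_A_inf x = \<infinity>"
  shows "filterlim (path_A x) at_top sequentially"
proof -
  have "incseq (\<lambda>n. ereal (path_A x n))"
    unfolding path_A_def by (intro incseq_SucI) simp
  then have "(\<lambda>n. ereal (path_A x n)) \<longlonglongrightarrow> path_A_inf x"
    unfolding path_A_inf_def
    using LIMSEQ_SUP limI by metis
  with assms show ?thesis
    by (simp add: tendsto_PInfty_eq_at_top)
qed

lemma sum_list_history: "(\<Sum>x\<leftarrow>history x n. f x) = (\<Sum>i<n. f (x i))"
  by (simp add: history_def comp_def interv_sum_list_conv_sum_set_nat atLeast0LessThan)

theorem proposition4p6:
  fixes \<epsilon>0 :: real
  assumes "0 < \<epsilon>0"
    and "\<forall>\<epsilon>. 0 < \<epsilon> \<and> \<epsilon> \<le> \<epsilon>0 \<longrightarrow> 0 < ln (ln (1 / \<epsilon>))"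
  shows "weakly_forces (bayes_initial (lil_prior \<epsilon>0)) (bayes_strategy (lil_prior \<epsilon>0))
           {x \<in> paths. path_A_inf x = \<infinity> \<longrightarrow>
              limsup (\<lambda>n. ereal (path_sum x n / sqrt (2 * (path_A x n)\<^sup>2 * ln (ln ((path_A x n)\<^sup>2))))) \<le> 1}"
proof -
  interpret lil_threshold \<epsilon>0
    using assms by unfold_locales auto
  have hist: "\<forall>y\<in>set (history x n). -1 \<le> y" if "x \<in> paths" for x n
    using that by (auto simp: paths_def history_def)
  have cap: "capital (bayes_initial (lil_prior \<epsilon>0)) (bayes_strategy (lil_prior \<epsilon>0)) (history x n)
      = bayes_capital (lil_prior \<epsilon>0) (history x n)" if "x \<in> paths" for x n
    using capital_bayes_strategy[OF prior_integral(1) _ hist[OF that]] prior_nonneg by simp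
  have "limsup (\<lambda>n. ereal (bayes_capital (lil_prior \<epsilon>0) (history x n))) = \<infinity>"
    if x: "x \<in> paths" and inf: "path_A_inf x = \<infinity>"
      and gt: "1 < limsup (\<lambda>n. ereal (path_sum x n / sqrt (2 * (path_A x n)\<^sup>2 * ln (ln ((path_A x n)\<^sup>2)))))"
    for x
  proof (rule limsup_eq_infinityI)
    fix C :: real
    have lim: "filterlim (path_A x) at_top sequentially"
      using path_A_tendsto_at_top[OF inf] .
    obtain r where r: "1 < r" and freq: "frequently (\<lambda>n.
        r < path_sum x n / sqrt (2 * (path_A x n)\<^sup>2 * ln (ln ((path_A x n)\<^sup>2)))) sequentially"
      using limsup_gt_imp_frequently_gt[OF gt[unfolded one_ereal_def]] .
    \<comment> \<open>For small \<open>A\<close> the divisor may be zero or negative, as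
      \<open>ln\<close> and \<open>sqrt\<close> are total; the quotient can be cleared only once it
      is positive.\<close>
    have "eventually (\<lambda>A::real. 0 < 2 * A\<^sup>2 * ln (ln (A\<^sup>2))) at_top"
      by real_asymp
    from eventually_compose_filterlim[OF this lim]
    have "eventually (\<lambda>n. 0 < 2 * (path_A x n)\<^sup>2 * ln (ln ((path_A x n)\<^sup>2))) sequentially" .
    moreover note eventually_compose_filterlim[OF eventually_bayes_capital_ge[OF r, of C] lim]
    ultimately have "eventually (\<lambda>n.
        r < path_sum x n / sqrt (2 * (path_A x n)\<^sup>2 * ln (ln ((path_A x n)\<^sup>2))) \<longrightarrow>
        C \<le> bayes_capital (lil_prior \<epsilon>0) (history x n)) sequentially"
    proof eventually_elim
      case (elim n)
      have "(\<Sum>y\<leftarrow>history x n. y\<^sup>2) = (path_A x n)\<^sup>2"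
        unfolding sum_list_history path_A_def by (simp add: sum_nonneg)
      moreover have "sum_list (history x n) = path_sum x n"
        using sum_list_history[of "\<lambda>y. y" x n] by (simp add: path_sum_def)
      moreover have "0 < sqrt (2 * (path_A x n)\<^sup>2 * ln (ln ((path_A x n)\<^sup>2)))"
        using elim(1) by (rule real_sqrt_gt_zero)
      ultimately show ?case
        using elim(2) hist[OF x, of n] by (auto simp: pos_less_divide_eq)
    qed
    with freq show "frequently (\<lambda>n. C \<le> bayes_capital (lil_prior \<epsilon>0) (history x n)) sequentially"
      by (rule frequently_rev_mp)
  qed
  then show ?thesis
    unfolding weakly_forces_def
    using bayes_initial_pos bayes_capital_nonneg[OF _ hist] prior_nonneg
    by (auto simp: cap not_le)
qed

end
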